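(* Let $G$ be a connected graph of order $n$ whose maximum vertex degree satisfies $\Delta(G) = n-2$. Then $\gamma_s(\mu(G)) \leq 4$.
   Context: All graphs are finite, simple, undirected, with nonempty vertex set; the order of a graph is its number of vertices, and $\Delta(G)$ denotes the maximum degree of a vertex of $G$. A set $S\subseteq V(G)$ is a dominating set of $G$ if every vertex of $V(G)\setminus S$ is adjacent to some vertex of $S$. A dominating set $S$ is a secure dominating set of $G$ if for every $u\in V(G)\setminus S$ there is $v\in S$ adjacent to $u$ such that $(S\setminus\{v\})\cup\{u\}$ is a dominating set of $G$. The secure domination number $\gamma_s(G)$ is the minimum cardinality of a secure dominating set of $G$. For a graph $G$ with vertices $v_1,\dots,v_n$, the Mycielskian $\mu(G)$ is the graph with vertex set $\{v_1,\dots,v_n,u_1,\dots,u_n,w\}$ ($2n+1$ distinct vertices) whose edges are: all edges of $G$; the edges $wu_i$ for $1\le i\le n$; and, for each edge $v_iv_j$ of $G$, the edges $u_iv_j$ and $v_iu_j$. *)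

theory Defs
  imports "Graph_Theory.Graph_Theory"
begin

text \<open>A finite simple undirected graph is a \<^locale>\<open>pair_graph\<close>: a finite, loop-free, symmetric
  set of ordered pairs, in which each edge is represented by its two orientations. Hence adjacency
  of u and v is membership of (u, v) in the arc set, and the degree of a vertex is its out-degree.\<close>

definition max_degree :: "'a pair_pre_digraph \<Rightarrow> nat" where
  "max_degree G = Max (out_degree (with_proj G) ` pverts G)"

definition dominating_set :: "'a pair_pre_digraph \<Rightarrow> 'a set \<Rightarrow> bool" where
  "dominating_set G S \<longleftrightarrow>
     S \<subseteq> pverts G \<and> (\<forall>u \<in> pverts G - S. \<exists>v \<in> S. (u, v) \<in> parcs G)"

definition secure_dominating_set :: "'a pair_pre_digraph \<Rightarrow> 'a set \<Rightarrow> bool" where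
  "secure_dominating_set G S \<longleftrightarrow>
     dominating_set G S \<and>
     (\<forall>u \<in> pverts G - S. \<exists>v \<in> S. (u, v) \<in> parcs G \<and> dominating_set G ((S - {v}) \<union> {u}))"

definition secure_domination_number :: "'a pair_pre_digraph \<Rightarrow> nat" where
  "secure_domination_number G = Min {card S | S. secure_dominating_set G S}"

text \<open>The minimum is over a finite nonempty set.\<close>

lemma secure_dominating_set_pverts: "secure_dominating_set G (pverts G)"
  by (simp add: secure_dominating_set_def dominating_set_def)

lemma finite_secure_dominating_set_cards:
  assumes "finite (pverts G)"
  shows "finite {card S | S. secure_dominating_set G S}"
proof (rule finite_subset)
  show "{card S | S. secure_dominating_set G S} \<subseteq> card ` Pow (pverts G)"
    by (auto simp: secure_dominating_set_def dominating_set_def)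
qed (use assms in simp)

text \<open>For the vertex v of G, \<open>Orig v\<close> is the vertex v itself, \<open>Copy v\<close> is its twin
  (the vertex u with the same index), and \<open>Apex\<close> is the vertex w.\<close>

datatype 'a mycielski_vertex = Orig 'a | Copy 'a | Apex

definition mycielskian :: "'a pair_pre_digraph \<Rightarrow> 'a mycielski_vertex pair_pre_digraph" where
  "mycielskian G =
     \<lparr> pverts = Orig ` pverts G \<union> Copy ` pverts G \<union> {Apex},
       parcs = {(Orig x, Orig y) | x y. (x, y) \<in> parcs G}
             \<union> {(Apex, Copy x) | x. x \<in> pverts G} \<union> {(Copy x, Apex) | x. x \<in> pverts G}
             \<union> {(Copy x, Orig y) | x y. (x, y) \<in> parcs G}
             \<union> {(Orig x, Copy y) | x y. (x, y) \<in> parcs G} \<rparr>"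

lemma pair_graph_mycielskian:
  assumes "pair_graph G"
  shows "pair_graph (mycielskian G)"
proof -
  interpret G: pair_graph G by fact
  let ?M = "mycielskian G"
  have wf: "fst e \<in> pverts ?M \<and> snd e \<in> pverts ?M" if "e \<in> parcs ?M" for e
    using that by (auto simp: mycielskian_def dest: G.in_arcsD1 G.in_arcsD2)
  have fin: "finite (pverts ?M)"
    by (simp add: mycielskian_def)
  have "parcs ?M \<subseteq> pverts ?M \<times> pverts ?M"
    using wf by (auto simp: mem_Times_iff)
  then have fin_arcs: "finite (parcs ?M)"
    using fin by (meson finite_SigmaI finite_subset)
  have sym: "symmetric (with_proj ?M)"
    by (auto simp: symmetric_def sym_def mycielskian_def dest: G.arcs_symmetric)
  have loopfree: "fst e \<noteq> snd e" if "e \<in> parcs ?M" for e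
    using that by (auto simp: mycielskian_def dest: G.no_loops')
  show ?thesis
    by unfold_locales (use wf fin fin_arcs sym loopfree in auto)
qed

lemma card_mycielskian:
  assumes "finite (pverts G)"
  shows "card (pverts (mycielskian G)) = 2 * card (pverts G) + 1"
proof -
  have "card (Orig ` pverts G \<union> Copy ` pverts G) = 2 * card (pverts G)"
    using assms by (subst card_Un_disjoint) (auto simp: card_image inj_on_def)
  then show ?thesis
    using assms by (auto simp: mycielskian_def card_insert_if)
qed

end

theory Submission
  imports Defs
begin

text \<open>
  Let \<open>v\<close> be a vertex of degree \<open>n - 2\<close> and \<open>x\<close> the only other vertex that is not adjacent
  to \<open>v\<close>. The four vertices \<open>Orig v\<close>, \<open>Copy v\<close>, \<open>Orig x\<close>, \<open>Apex\<close> form a secure dominating set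
  of the Mycielskian.

  The set has enough redundancy because \<open>Orig v\<close> and \<open>Copy v\<close> both dominate all original
  neighbours of \<open>v\<close>, while all copies are dominated by \<open>Apex\<close> and those of neighbours of \<open>v\<close>
  also by \<open>Orig v\<close>. An attack on an original neighbour of \<open>v\<close> is answered by \<open>Copy v\<close>, since
  the three remaining vertices already dominate. An attack on \<open>Copy a\<close> with \<open>a\<close> a neighbour of
  \<open>v\<close> is answered by \<open>Orig v\<close>: its neighbours remain dominated by \<open>Copy v\<close>, and \<open>Orig v\<close>
  itself by \<open>Copy a\<close>. The last possible attack, on \<open>Copy x\<close>, is answered by \<open>Apex\<close>, as then
  \<open>Copy v\<close> and \<open>Copy x\<close> are in the set and \<open>Orig v\<close> dominates the other copies.
\<close>

lemma mycielskian_arcs [simp]: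
  "(Orig a, Orig b) \<in> parcs (mycielskian G) \<longleftrightarrow> (a, b) \<in> parcs G"
  "(Orig a, Copy b) \<in> parcs (mycielskian G) \<longleftrightarrow> (a, b) \<in> parcs G"
  "(Copy a, Orig b) \<in> parcs (mycielskian G) \<longleftrightarrow> (a, b) \<in> parcs G"
  "(Copy a, Apex) \<in> parcs (mycielskian G) \<longleftrightarrow> a \<in> pverts G"
  "(Apex, Copy a) \<in> parcs (mycielskian G) \<longleftrightarrow> a \<in> pverts G"
  by (auto simp: mycielskian_def)

lemma pverts_mycielskian:
  "pverts (mycielskian G) = Orig ` pverts G \<union> Copy ` pverts G \<union> {Apex}"
  by (simp add: mycielskian_def)

lemma secure_domination_number_le_card:
  assumes "finite (pverts G)" and "secure_dominating_set G S"
  shows "secure_domination_number G \<le> card S"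
  unfolding secure_domination_number_def
  by (rule Min_le) (use assms finite_secure_dominating_set_cards in auto)

lemma (in pair_graph) out_degree_eq_card_neighbours:
  "out_degree (with_proj G) v = card {u. (v, u) \<in> parcs G}"
proof -
  have "out_arcs (with_proj G) v = Pair v ` {u. (v, u) \<in> parcs G}"
    by (auto simp: out_arcs_def)
  then show ?thesis
    by (simp add: out_degree_def card_image inj_on_def)
qed

text \<open>Since there are no loops, a vertex of degree \<open>n - 2\<close> has its \<open>n - 2\<close> neighbours among the
  \<open>n - 1\<close> other vertices, and so misses exactly one of them.\<close>

lemma (in pair_graph) obtain_unique_non_neighbour:
  assumes deg: "int (max_degree G) = int (card (pverts G)) - 2"
  obtains v x where "v \<in> pverts G" "x \<in> pverts G" "x \<noteq> v"
    and "\<And>a. a \<in> pverts G \<Longrightarrow> a = v \<or> a = x \<or> (a, v) \<in> parcs G"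
proof -
  have "pverts G \<noteq> {}"
    using deg by auto
  then have "max_degree G \<in> out_degree (with_proj G) ` pverts G"
    unfolding max_degree_def by (intro Max_in) auto
  then obtain v where v: "v \<in> pverts G" "max_degree G = out_degree (with_proj G) v"
    by blast
  define N where "N = {u. (v, u) \<in> parcs G}"
  have N: "N \<subseteq> pverts G - {v}"
    by (auto simp: N_def dest: in_arcsD2 no_loops')
  then have "card (pverts G - {v} - N) = card (pverts G) - 1 - card N"
    using v(1) by (simp add: card_Diff_subset finite_subset)
  also have "\<dots> = 1"
    using deg v(2) by (simp add: out_degree_eq_card_neighbours N_def)
  finally obtain x where x: "pverts G - {v} - N = {x}"
    by (auto simp: card_1_singleton_iff)
  then have "a = v \<or> a = x \<or> (a, v) \<in> parcs G" if "a \<in> pverts G" for a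
    using that by (auto simp: N_def intro: arcs_symmetric)
  then show ?thesis
    using that v(1) x by blast
qed

text \<open>A copy of a neighbour of \<open>v\<close> is adjacent to both \<open>Orig v\<close> and \<open>Apex\<close>. It is \<open>Orig v\<close> that
  moves there, because \<open>Copy x\<close> has no neighbour in the set other than \<open>Apex\<close> when \<open>x\<close> is not
  adjacent to \<open>v\<close>.\<close>

lemma (in pair_graph) secure_dominating_set_mycielskian:
  assumes v: "v \<in> pverts G" and x: "x \<in> pverts G" "x \<noteq> v"
    and nbr: "\<And>a. a \<in> pverts G \<Longrightarrow> a = v \<or> a = x \<or> (a, v) \<in> parcs G"
  shows "secure_dominating_set (mycielskian G) {Orig v, Copy v, Orig x, Apex}"
    (is "secure_dominating_set ?M ?S")
proof -
  have superset: "dominating_set ?M T"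
    if "dominating_set ?M S" "S \<subseteq> T" "T \<subseteq> pverts ?M" for S T
    using that unfolding dominating_set_def by blast
  have dom: "dominating_set ?M {Orig v, Orig x, Apex}"
    using v x by (auto simp: dominating_set_def pverts_mycielskian dest: nbr)
  have without_Orig: "dominating_set ?M {Copy a, Copy v, Orig x, Apex}"
    if "(a, v) \<in> parcs G" for a
    using that arcs_symmetric[OF that] v x
    by (auto simp: dominating_set_def pverts_mycielskian dest: nbr in_arcsD1)
  have without_Apex: "dominating_set ?M {Orig v, Copy v, Orig x, Copy x}"
    using v x by (auto simp: dominating_set_def pverts_mycielskian dest: nbr)
  have sub: "?S \<subseteq> pverts ?M"
    using v x by (auto simp: pverts_mycielskian)
  have "\<exists>s \<in> ?S. (u, s) \<in> parcs ?M \<and> dominating_set ?M ((?S - {s}) \<union> {u})"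
    if u: "u \<in> pverts ?M - ?S" for u
  proof -
    consider a where "u = Orig a" "(a, v) \<in> parcs G"
      | a where "u = Copy a" "(a, v) \<in> parcs G"
      | "u = Copy x"
      using u by (auto simp: pverts_mycielskian dest: nbr)
    then show ?thesis
    proof cases
      case 1
      have "dominating_set ?M ((?S - {Copy v}) \<union> {u})"
        by (rule superset[OF dom]) (use sub u in auto)
      then show ?thesis
        using 1 by (intro bexI[of _ "Copy v"]) auto
    next
      case 2
      have "dominating_set ?M ((?S - {Orig v}) \<union> {u})"
        by (rule superset[OF without_Orig[OF 2(2)]]) (use sub u 2 x in auto)
      then show ?thesis
        using 2 by (intro bexI[of _ "Orig v"]) auto
    next
      case 3
      have "dominating_set ?M ((?S - {Apex}) \<union> {u})"
        by (rule superset[OF without_Apex]) (use sub u 3 in auto)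
      then show ?thesis
        using 3 x by (intro bexI[of _ Apex]) auto
    qed
  qed
  moreover have "dominating_set ?M ?S"
    by (rule superset[OF dom _ sub]) auto
  ultimately show ?thesis
    unfolding secure_dominating_set_def by blast
qed

theorem theorem2p2:
  fixes G :: "'a pair_pre_digraph" and n :: nat
  assumes "pair_graph G"
    and "connected (with_proj G)"
    and "card (pverts G) = n"
    and "int (max_degree G) = int n - 2"
  shows "secure_domination_number (mycielskian G) \<le> 4"
proof -
  interpret pair_graph G by fact
  obtain v x where "v \<in> pverts G" "x \<in> pverts G" "x \<noteq> v"
    and "\<And>a. a \<in> pverts G \<Longrightarrow> a = v \<or> a = x \<or> (a, v) \<in> parcs G"
    using obtain_unique_non_neighbour assms(3,4) by blast
  then have "secure_dominating_set (mycielskian G) {Orig v, Copy v, Orig x, Apex}"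
    by (rule secure_dominating_set_mycielskian)
  then have "secure_domination_number (mycielskian G) \<le> card {Orig v, Copy v, Orig x, Apex}"
    by (intro secure_domination_number_le_card) (simp_all add: pverts_mycielskian)
  also have "\<dots> \<le> 4"
    by (simp add: card_insert_if)
  finally show ?thesis .
qed

end
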